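(* For every graph $G$ and every integer $d \ge 2$, $\Gamma_d(G,d) = \alpha(G)$.
   Context: $\alpha(G)$ is the independence number of $G$. In a digraph $D$, $d_D(u,v)$ is the length of a shortest directed path from $u$ to $v$. A directed $d$-distance dominating set of $D$ is a set $U \subseteq V(D)$ such that every $v \notin U$ has some $u \in U$ with $d_D(u,v) \le d$; $\gamma(D,d)$ is the minimum size of such a set. For a graph $G$, $\Gamma_d(G,d) = \max\{\gamma(D,d) : D \text{ an orientation of } G\}$. *)

theory Defs
  imports "Graph_Theory.Pair_Digraph" "HOL-Library.Extended_Nat"
begin

text \<open>
  As in the library, a finite simple graph is a \<^locale>\<open>pair_graph\<close>: a finite
  symmetric loop-free digraph in which an edge \<open>uv\<close> is represented by the two arcs
  \<open>(u, v)\<close> and \<open>(v, u)\<close>. In a finite graph all the families under \<open>Min\<close> and \<open>Max\<close>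
  below are finite and nonempty.
\<close>

definition independent_set :: "'a pair_pre_digraph \<Rightarrow> 'a set \<Rightarrow> bool" where
  "independent_set G S \<longleftrightarrow> S \<subseteq> pverts G \<and> (\<forall>u\<in>S. \<forall>v\<in>S. (u, v) \<notin> parcs G)"

definition independence_number :: "'a pair_pre_digraph \<Rightarrow> nat" where
  "independence_number G = Max (card ` {S. independent_set G S})"

definition orientation :: "'a pair_pre_digraph \<Rightarrow> 'a pair_pre_digraph \<Rightarrow> bool" where
  "orientation G D \<longleftrightarrow> pverts D = pverts G \<and> parcs D \<subseteq> parcs G \<and>
     (\<forall>(u, v)\<in>parcs G. (u, v) \<in> parcs D \<longleftrightarrow> (v, u) \<notin> parcs D)"

text \<open>The infimum is \<open>\<infinity>\<close> if there is no directed path from \<open>u\<close> to \<open>v\<close>.\<close>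

definition ddist :: "'a pair_pre_digraph \<Rightarrow> 'a \<Rightarrow> 'a \<Rightarrow> enat" where
  "ddist D u v = (INF p\<in>{p. pre_digraph.apath (with_proj D) u p v}. enat (length p))"

definition dist_dominating_set :: "'a pair_pre_digraph \<Rightarrow> nat \<Rightarrow> 'a set \<Rightarrow> bool" where
  "dist_dominating_set D d U \<longleftrightarrow> U \<subseteq> pverts D \<and>
     (\<forall>v\<in>pverts D - U. \<exists>u\<in>U. ddist D u v \<le> enat d)"

definition dist_domination_number :: "'a pair_pre_digraph \<Rightarrow> nat \<Rightarrow> nat" where
  "dist_domination_number D d = Min (card ` {U. dist_dominating_set D d U})"

definition upper_orientable_dist_domination_number :: "'a pair_pre_digraph \<Rightarrow> nat \<Rightarrow> nat" where
  "upper_orientable_dist_domination_number G d =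
     Max ((\<lambda>D. dist_domination_number D d) ` {D. orientation G D})"

end

theory Submission
  imports Defs
begin

text \<open>
  The upper bound is the Chvatal--Lovasz theorem: every finite loop-free digraph has an
  independent set from which every vertex is reachable in at most two steps. For the lower
  bound, orient all edges at a maximum independent set \<open>S\<close> away from \<open>S\<close>: the vertices
  of \<open>S\<close> become sources, and a source belongs to every dominating set.
\<close>

text \<open>Induction on the vertex set: delete a vertex \<open>x\<close> together with its
  out-neighbours and take a suitable \<open>S\<close> for the rest. If an arc leads from
  \<open>S\<close> to \<open>x\<close>, then \<open>S\<close> still works; otherwise
  \<open>insert x S\<close> does. The midpoint \<open>w\<close> is confined to \<open>V\<close>, so
  that the claim is about the subdigraph induced by \<open>V\<close> while \<open>A\<close> stays
  fixed.\<close>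

lemma chvatal_lovasz_quasi_kernel:
  fixes A :: "('a \<times> 'a) set"
  assumes "finite V" and "\<And>x. (x, x) \<notin> A"
  obtains S where "S \<subseteq> V" and "\<And>u v. u \<in> S \<Longrightarrow> v \<in> S \<Longrightarrow> (u, v) \<notin> A"
    and "\<And>v. v \<in> V - S \<Longrightarrow> \<exists>u\<in>S. (u, v) \<in> A \<or> (\<exists>w\<in>V. (u, w) \<in> A \<and> (w, v) \<in> A)"
proof -
  have "\<exists>S\<subseteq>V. (\<forall>u\<in>S. \<forall>v\<in>S. (u, v) \<notin> A) \<and>
      (\<forall>v\<in>V - S. \<exists>u\<in>S. (u, v) \<in> A \<or> (\<exists>w\<in>V. (u, w) \<in> A \<and> (w, v) \<in> A))"
    using assms(1)
  proof (induction V rule: finite_psubset_induct)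
    case (psubset V)
    show ?case
    proof (cases "V = {}")
      case True
      then show ?thesis by blast
    next
      case False
      then obtain x where x: "x \<in> V" by blast
      define W where "W = V - {x} - A `` {x}"
      have "W \<subset> V" using x by (auto simp: W_def)
      from psubset.IH[OF this] obtain S where S: "S \<subseteq> W" "\<forall>u\<in>S. \<forall>v\<in>S. (u, v) \<notin> A"
        "\<forall>v\<in>W - S. \<exists>u\<in>S. (u, v) \<in> A \<or> (\<exists>w\<in>W. (u, w) \<in> A \<and> (w, v) \<in> A)" by blast
      have WV: "W \<subseteq> V" by (auto simp: W_def)
      show ?thesis
      proof (cases "\<exists>u\<in>S. (u, x) \<in> A")
        case True
        have "\<exists>u\<in>S. (u, v) \<in> A \<or> (\<exists>w\<in>V. (u, w) \<in> A \<and> (w, v) \<in> A)" if "v \<in> V - S" for v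
        proof (cases "v \<in> W")
          case True
          then show ?thesis using S(3) WV that by blast
        next
          case False
          \<comment> \<open>The deleted vertices are \<open>x\<close> and its out-neighbours, so
            \<open>S\<close> reaches each of them in at most two steps, by way of
            \<open>x\<close>.\<close>
          then have "v = x \<or> (x, v) \<in> A" using that by (auto simp: W_def)
          then show ?thesis using \<open>\<exists>u\<in>S. (u, x) \<in> A\<close> x by blast
        qed
        then have "\<forall>v\<in>V - S. \<exists>u\<in>S. (u, v) \<in> A \<or> (\<exists>w\<in>V. (u, w) \<in> A \<and> (w, v) \<in> A)"
          by (rule ballI)
        moreover have "S \<subseteq> V" using S(1) WV by (rule order_trans)
        ultimately show ?thesis by (intro exI[of _ S] conjI S(2))
      next
        case False
        \<comment> \<open>Arcs from \<open>x\<close> into \<open>S\<close> are impossible because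
          \<open>W\<close> omits the out-neighbours of \<open>x\<close>; arcs from \<open>S\<close>
          to \<open>x\<close> are ruled out by the case assumption.\<close>
        have "(x, v) \<notin> A" if "v \<in> S" for v using S(1) that by (auto simp: W_def)
        then have "\<forall>u\<in>insert x S. \<forall>v\<in>insert x S. (u, v) \<notin> A"
          using False S(2) assms(2) by blast
        moreover have "\<forall>v\<in>V - insert x S.
            \<exists>u\<in>insert x S. (u, v) \<in> A \<or> (\<exists>w\<in>V. (u, w) \<in> A \<and> (w, v) \<in> A)"
        proof
          fix v assume v: "v \<in> V - insert x S"
          show "\<exists>u\<in>insert x S. (u, v) \<in> A \<or> (\<exists>w\<in>V. (u, w) \<in> A \<and> (w, v) \<in> A)"
          proof (cases "v \<in> W")
            case True
            then show ?thesis using S(3) WV v by blast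
          next
            case False
            then show ?thesis using v by (auto simp: W_def)
          qed
        qed
        moreover have "insert x S \<subseteq> V" using S(1) WV x by blast
        ultimately show ?thesis by (intro exI[of _ "insert x S"] conjI)
      qed
    qed
  qed
  then obtain S where S: "S \<subseteq> V" "\<forall>u\<in>S. \<forall>v\<in>S. (u, v) \<notin> A"
    "\<forall>v\<in>V - S. \<exists>u\<in>S. (u, v) \<in> A \<or> (\<exists>w\<in>V. (u, w) \<in> A \<and> (w, v) \<in> A)"
    by (elim exE conjE)
  show ?thesis by (rule that[OF S(1) S(2)[rule_format] S(3)[rule_format]])
qed

lemma ddist_le_length:
  assumes "pre_digraph.apath (with_proj D) u p v"
  shows "ddist D u v \<le> enat (length p)"
  unfolding ddist_def using assms by (auto intro: INF_lower)

lemma ddist_arc: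
  assumes "u \<in> pverts D" "v \<in> pverts D" "(u, v) \<in> parcs D" "u \<noteq> v"
  shows "ddist D u v \<le> 1"
proof -
  have "pre_digraph.apath (with_proj D) u [(u, v)] v"
    using assms by (simp add: pre_digraph.apath_def pre_digraph.awalk_def
        pre_digraph.awalk_verts.simps pre_digraph.cas.simps)
  from ddist_le_length[OF this] show ?thesis by (simp add: one_enat_def)
qed

text \<open>The three disequalities are there because an \<open>apath\<close> must not repeat a
  vertex.\<close>

lemma ddist_two_arcs:
  assumes "u \<in> pverts D" "w \<in> pverts D" "v \<in> pverts D"
    "(u, w) \<in> parcs D" "(w, v) \<in> parcs D" "u \<noteq> w" "w \<noteq> v" "u \<noteq> v"
  shows "ddist D u v \<le> 2"
proof -
  have "pre_digraph.apath (with_proj D) u [(u, w), (w, v)] v"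
    using assms by (simp add: pre_digraph.apath_def pre_digraph.awalk_def
        pre_digraph.awalk_verts.simps pre_digraph.cas.simps)
  from ddist_le_length[OF this] show ?thesis by (simp add: numeral_eq_enat numeral_2_eq_2)
qed

text \<open>The last arc of a nonempty path to \<open>v\<close> would enter \<open>v\<close>, and
  the empty path would force \<open>u = v\<close>.\<close>

lemma ddist_source:
  assumes "\<And>w. (w, v) \<notin> parcs D" and "u \<noteq> v"
  shows "ddist D u v = \<infinity>"
proof -
  have "\<not> pre_digraph.apath (with_proj D) u p v" for p
  proof
    assume "pre_digraph.apath (with_proj D) u p v"
    then have cas: "pre_digraph.cas (with_proj D) u p v" and sub: "set p \<subseteq> parcs D"
      by (auto simp: pre_digraph.apath_def pre_digraph.awalk_def)
    have "\<exists>w. (w, v) \<in> parcs D" using cas sub \<open>u \<noteq> v\<close>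
    \<comment> \<open>If the first arc ends at \<open>v\<close>, it is the arc sought; otherwise the
      remaining arcs lead to \<open>v\<close> from a vertex other than \<open>v\<close>, and the
      induction hypothesis applies.\<close>
    proof (induction p arbitrary: u)
      case Nil
      then show ?case by (simp add: pre_digraph.cas.simps)
    next
      case (Cons e p)
      then show ?case
        by (cases e; cases "snd e = v") (auto simp: pre_digraph.cas.simps)
    qed
    then show False using assms(1) by blast
  qed
  \<comment> \<open>An infimum over the empty family is the top element of
    \<open>enat\<close>.\<close>
  then show ?thesis by (simp add: ddist_def top_enat_def)
qed

lemma card_le_independence_number:
  assumes "finite (pverts G)" and "independent_set G S"
  shows "card S \<le> independence_number G"
proof -
  have "finite {S. independent_set G S}"
    by (rule finite_subset[of _ "Pow (pverts G)"]) (auto simp: independent_set_def assms(1))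
  then show ?thesis using assms(2) by (auto simp: independence_number_def)
qed

lemma independence_number_attained:
  assumes "finite (pverts G)"
  obtains S where "independent_set G S" and "card S = independence_number G"
proof -
  have "finite {S. independent_set G S}"
    by (rule finite_subset[of _ "Pow (pverts G)"]) (auto simp: independent_set_def assms(1))
  moreover have "independent_set G {}" by (simp add: independent_set_def)
  ultimately have "independence_number G \<in> card ` {S. independent_set G S}"
    unfolding independence_number_def by (intro Max_in) auto
  then show ?thesis using that by force
qed

lemma finite_dist_dominating_sets:
  assumes "finite (pverts D)"
  shows "finite {U. dist_dominating_set D d U}"
  by (rule finite_subset[of _ "Pow (pverts D)"]) (auto simp: dist_dominating_set_def assms)

lemma dist_domination_number_le:
  assumes "finite (pverts D)" and "dist_dominating_set D d U"
  shows "dist_domination_number D d \<le> card U"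
  using finite_dist_dominating_sets[OF assms(1)] assms(2)
  by (auto simp: dist_domination_number_def)

lemma dist_domination_number_attained:
  assumes "finite (pverts D)"
  obtains U where "dist_dominating_set D d U" and "card U = dist_domination_number D d"
proof -
  \<comment> \<open>This vacuous example keeps the family under \<open>Min\<close> nonempty.\<close>
  have "dist_dominating_set D d (pverts D)" by (simp add: dist_dominating_set_def)
  then have "dist_domination_number D d \<in> card ` {U. dist_dominating_set D d U}"
    unfolding dist_domination_number_def
    using finite_dist_dominating_sets[OF assms, of d] by (intro Min_in) auto
  then show ?thesis using that by force
qed

lemma dist_domination_number_le_independence_number:
  assumes "pair_graph G" and "orientation G D" and "d \<ge> 2"
  shows "dist_domination_number D d \<le> independence_number G"
proof -
  interpret pair_graph G by fact
  have V: "pverts D = pverts G" and sub: "parcs D \<subseteq> parcs G"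
    and one_of: "\<And>u v. (u, v) \<in> parcs G \<Longrightarrow> (u, v) \<in> parcs D \<or> (v, u) \<in> parcs D"
    using assms(2) by (auto simp: orientation_def)
  have loopfree: "(x, x) \<notin> parcs D" for x using sub no_loops by fastforce
  have fin: "finite (pverts D)" by (simp add: V)
  obtain S where S: "S \<subseteq> pverts D" "\<And>u v. u \<in> S \<Longrightarrow> v \<in> S \<Longrightarrow> (u, v) \<notin> parcs D"
    and reach: "\<And>v. v \<in> pverts D - S \<Longrightarrow> \<exists>u\<in>S. (u, v) \<in> parcs D \<or>
      (\<exists>w\<in>pverts D. (u, w) \<in> parcs D \<and> (w, v) \<in> parcs D)"
    using chvatal_lovasz_quasi_kernel[OF fin, of "parcs D"] loopfree by blast
  \<comment> \<open>An edge of \<open>G\<close> inside \<open>S\<close> would leave one of its two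
    arcs in \<open>D\<close>, so independence in \<open>D\<close> carries over to
    \<open>G\<close>.\<close>
  have "independent_set G S" using S V one_of by (fastforce simp: independent_set_def)
  moreover have "dist_dominating_set D d S"
    unfolding dist_dominating_set_def
  proof (intro conjI ballI)
    fix v assume v: "v \<in> pverts D - S"
    from reach[OF v] obtain u where u: "u \<in> S" and
      "(u, v) \<in> parcs D \<or> (\<exists>w\<in>pverts D. (u, w) \<in> parcs D \<and> (w, v) \<in> parcs D)" by blast
    \<comment> \<open>The vertices on these paths are distinct: the ends since \<open>u\<close> lies
      in \<open>S\<close> and \<open>v\<close> does not, neighbouring ones since \<open>D\<close>
      has no loops.\<close>
    then have "ddist D u v \<le> 1 \<or> ddist D u v \<le> 2"
      using ddist_arc[of u D v] ddist_two_arcs[of u D _ v] v S(1) loopfree by blast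
    moreover have "(1::enat) \<le> enat d" "(2::enat) \<le> enat d"
      using assms(3) by (auto simp: one_enat_def numeral_eq_enat)
    ultimately show "\<exists>u\<in>S. ddist D u v \<le> enat d" using u order_trans by blast
  qed (fact S(1))
  ultimately show ?thesis
    using dist_domination_number_le[OF fin] card_le_independence_number[of G S] V fin
    by fastforce
qed

lemma orientation_away_from_independent_set:
  assumes "pair_graph G" and "independent_set G S"
  obtains D where "orientation G D" and "\<And>u v. v \<in> S \<Longrightarrow> (u, v) \<notin> parcs D"
proof -
  interpret pair_graph G by fact
  \<comment> \<open>The injective numbering only serves to direct the edges that avoid
    \<open>S\<close>, from the smaller number to the larger; edges meeting \<open>S\<close> have
    exactly one end there and leave it.\<close>
  obtain f :: "'a \<Rightarrow> nat" where f: "inj_on f (pverts G)"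
    using finite_imp_inj_to_nat_seg[of "pverts G"] by auto
  define D where "D = \<lparr>pverts = pverts G,
    parcs = {(u, v) \<in> parcs G. u \<in> S \<or> v \<notin> S \<and> f u < f v}\<rparr>"
  have ind: "\<And>u v. u \<in> S \<Longrightarrow> v \<in> S \<Longrightarrow> (u, v) \<notin> parcs G"
    using assms(2) by (auto simp: independent_set_def)
  have "(u, v) \<in> parcs D \<longleftrightarrow> (v, u) \<notin> parcs D" if e: "(u, v) \<in> parcs G" for u v
  proof -
    have "(v, u) \<in> parcs G" using e arcs_symmetric by auto
    moreover have "u \<noteq> v" using e no_loops by fastforce
    moreover have "u \<in> pverts G" "v \<in> pverts G" using e wellformed by fastforce+
    ultimately have "f u \<noteq> f v" using f by (auto simp: inj_on_def)
    then show ?thesis using e \<open>(v, u) \<in> parcs G\<close> ind by (auto simp: D_def)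
  qed
  then have "orientation G D" by (auto simp: orientation_def D_def)
  moreover have "(u, v) \<notin> parcs D" if "v \<in> S" for u v
    using that ind by (auto simp: D_def)
  ultimately show ?thesis using that by blast
qed

text \<open>A source is at infinite distance from every other vertex, so whatever \<open>d\<close>
  is, it can be dominated only by belonging to the set itself.\<close>

lemma card_sources_le_dist_domination_number:
  assumes "finite (pverts D)" and "S \<subseteq> pverts D" and "\<And>u v. v \<in> S \<Longrightarrow> (u, v) \<notin> parcs D"
  shows "card S \<le> dist_domination_number D d"
proof -
  obtain U where U: "dist_dominating_set D d U" "card U = dist_domination_number D d"
    using dist_domination_number_attained[OF assms(1)] .
  have "S \<subseteq> U"
  proof (rule ccontr)
    assume "\<not> S \<subseteq> U"
    then obtain v where v: "v \<in> S" "v \<notin> U" by blast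
    then obtain u where "u \<in> U" "ddist D u v \<le> enat d"
      using U(1) assms(2) unfolding dist_dominating_set_def by blast
    moreover have "ddist D u v = \<infinity>"
      using \<open>u \<in> U\<close> v assms(3) by (intro ddist_source) auto
    ultimately show False by simp
  qed
  moreover have "finite U"
    using U(1) assms(1) finite_subset by (auto simp: dist_dominating_set_def)
  ultimately show ?thesis using card_mono U(2) by metis
qed

theorem theorem3p3:
  fixes G :: "'a pair_pre_digraph" and d :: nat
  assumes "pair_graph G" and "d \<ge> 2"
  shows "upper_orientable_dist_domination_number G d = independence_number G"
proof -
  interpret pair_graph G by fact
  let ?N = "(\<lambda>D. dist_domination_number D d) ` {D. orientation G D}"
  have le: "n \<le> independence_number G" if "n \<in> ?N" for n
    using that dist_domination_number_le_independence_number[OF assms(1) _ assms(2)] by auto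
  obtain S where S: "independent_set G S" "card S = independence_number G"
    using independence_number_attained[of G] by auto
  obtain D where D: "orientation G D" "\<And>u v. v \<in> S \<Longrightarrow> (u, v) \<notin> parcs D"
    using orientation_away_from_independent_set[OF assms(1) S(1)] by blast
  have "pverts D = pverts G" using D(1) by (simp add: orientation_def)
  then have "independence_number G \<le> dist_domination_number D d"
    using card_sources_le_dist_domination_number[of D S d] D(2) S
    by (auto simp: independent_set_def)
  moreover have "dist_domination_number D d \<in> ?N" using D(1) by blast
  \<comment> \<open>The orientation away from \<open>S\<close> attains the upper bound
    \<open>le\<close>.\<close>
  ultimately have "independence_number G \<in> ?N" using le by (metis order_antisym)
  \<comment> \<open>Finiteness, needed for \<open>Max\<close>, comes from the bound on the values
    and not from counting orientations.\<close>
  moreover have "finite ?N" using le by (meson finite_nat_set_iff_bounded_le)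
  ultimately show ?thesis
    unfolding upper_orientable_dist_domination_number_def using le by (intro Max_eqI) auto
qed

end
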